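(* For every $\varepsilon>0$ (with $\varepsilon<\pi/2$, so that the sector below is nonempty) there exist constants $C_\varepsilon,\kappa_\varepsilon>0$ such that for all $z\in\Sigma_{\frac\pi2-\varepsilon}$ and $y,\rho>0$: if $c<1$, $$|p_{B^d}(z,y,\rho)|\le C_\varepsilon|z|^{-\frac12}\Big(\frac y{|z|^{1/2}}\wedge1\Big)^{1-c}\Big(\frac\rho{|z|^{1/2}}\wedge1\Big)\exp\Big(-\frac{|y-\rho|^2}{\kappa_\varepsilon|z|}\Big),$$ and if $c>-1$, $$|p_{B^n}(z,y,\rho)|\le C_\varepsilon|z|^{-\frac12}\Big(\frac\rho{|z|^{1/2}}\wedge1\Big)^{c}\exp\Big(-\frac{|y-\rho|^2}{\kappa_\varepsilon|z|}\Big).$$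
   Context: $c\in\mathbb{R}$ is fixed; $\Sigma_\phi=\{z\in\mathbb{C}\setminus\{0\}:|\arg z|<\phi\}$; $a\wedge b=\min\{a,b\}$; $I_\nu$ is the modified Bessel function of the first kind. For $\mathrm{Re}\,z>0$ and $y,\rho>0$, $$p_{B^n}(z,y,\rho)=\frac1{2z}\rho^c(y\rho)^{\frac{1-c}2}\exp\Big\{-\frac{y^2+\rho^2}{4z}\Big\}I_{\frac{c-1}2}\Big(\frac{y\rho}{2z}\Big)\quad(c>-1),$$ $$p_{B^d}(z,y,\rho)=\frac1{2z}\rho^c(y\rho)^{\frac{1-c}2}\exp\Big\{-\frac{y^2+\rho^2}{4z}\Big\}I_{\frac{1-c}2}\Big(\frac{y\rho}{2z}\Big)\quad(c<1).$$ The constants may depend on $c$. *)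

theory Defs
  imports "HOL-Analysis.Analysis"
begin

definition sector :: "real \<Rightarrow> complex set" where
  "sector \<phi> = {z. z \<noteq> 0 \<and> \<bar>Arg z\<bar> < \<phi>}"

(* Modified Bessel function of the first kind, on the principal branch of z powr nu.
   The entire reciprocal Gamma function makes the series meaningful for every order nu. *)
definition bessel_I :: "complex \<Rightarrow> complex \<Rightarrow> complex" where
  "bessel_I \<nu> z = (z / 2) powr \<nu> * (\<Sum>k. (z\<^sup>2 / 4) ^ k / fact k * rGamma (\<nu> + of_nat k + 1))"

(* Intended for c > -1, Re z > 0 and y, \<rho> > 0. *)
definition p_Bn :: "real \<Rightarrow> complex \<Rightarrow> real \<Rightarrow> real \<Rightarrow> complex" where
  "p_Bn c z y \<rho> =
     1 / (2 * z) * of_real (\<rho> powr c * (y * \<rho>) powr ((1 - c) / 2)) *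
     exp (- (of_real (y\<^sup>2 + \<rho>\<^sup>2) / (4 * z))) *
     bessel_I (of_real ((c - 1) / 2)) (of_real (y * \<rho>) / (2 * z))"

(* Intended for c < 1, Re z > 0 and y, \<rho> > 0. *)
definition p_Bd :: "real \<Rightarrow> complex \<Rightarrow> real \<Rightarrow> real \<Rightarrow> complex" where
  "p_Bd c z y \<rho> =
     1 / (2 * z) * of_real (\<rho> powr c * (y * \<rho>) powr ((1 - c) / 2)) *
     exp (- (of_real (y\<^sup>2 + \<rho>\<^sup>2) / (4 * z))) *
     bessel_I (of_real ((1 - c) / 2)) (of_real (y * \<rho>) / (2 * z))"

end

theory Submission
  imports Defs
begin

text \<open>
  Poisson's integral writes \<open>I\<^sub>\<nu> w\<close>, for \<open>\<nu> > -1/2\<close>, as \<open>w powr \<nu>\<close> times an integral of \<open>cosh (w t)\<close>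
  against a positive weight, and \<open>\<bar>cosh (w t)\<bar> \<le> exp (t Re w)\<close>. Near \<open>t = 1\<close> the weight is of order
  \<open>(1 - t) powr (\<nu> - 1/2)\<close>, so that \<open>I\<^sub>\<nu> w\<close> is dominated by
  \<open>\<bar>w\<bar> powr \<nu> (1 + \<bar>w\<bar>) powr (- \<nu> - 1/2) exp (Re w)\<close> when \<open>Re w\<close> and \<open>\<bar>w\<bar>\<close> are comparable. The
  three-term recurrence extends this to \<open>\<nu> > -3/2\<close>. The factor \<open>exp (Re w)\<close> completes the square in
  the Gaussian. After rescaling by \<open>r = \<bar>z\<bar> powr (1/2)\<close> to \<open>Y = y / r\<close> and \<open>R = \<rho> / r\<close>, the numbers
  \<open>max Y 1\<close>, \<open>max R 1\<close> and \<open>sqrt (1 + Y R)\<close> are comparable up to powers of \<open>1 + \<bar>Y - R\<bar>\<close>, and these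
  powers are absorbed by half of the Gaussian.
\<close>

section \<open>Decay of the exponentially damped Beta integral\<close>

lemma exp_Beta_weight_integrable:
  fixes b K :: real
  assumes b: "b > 0"
  shows "(\<lambda>s. exp (- K * (1 - s)) * (s powr (1/2 - 1) * (1 - s) powr (b - 1))) integrable_on {0..1}"
proof -
  let ?B = "\<lambda>s::real. s powr (1/2 - 1) * (1 - s) powr (b - 1)"
  have "?B absolutely_integrable_on {0..1}"
    by (rule nonnegative_absolutely_integrable_1) (use integrable_Beta'[of "1/2" b] b in auto)
  moreover have "compact ((\<lambda>s. exp (- K * (1 - s))) ` {0..1})"
    by (intro compact_continuous_image continuous_intros) auto
  ultimately have "(\<lambda>s. exp (- K * (1 - s)) * ?B s) absolutely_integrable_on {0..1}"
    by (intro absolutely_integrable_bounded_measurable_product_real[of "\<lambda>s. exp (- K * (1 - s))"]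
          continuous_imp_measurable_on_sets_lebesgue continuous_intros compact_imp_bounded) auto
  thus ?thesis by (rule set_lebesgue_integral_eq_integral)
qed

text \<open>For large \<open>K\<close> the mass sits where \<open>1 - s\<close> is of order
  \<open>1 / K\<close>. For \<open>s \<ge> 1/2\<close> the factor \<open>s powr (1/2 - 1)\<close> is
  at most 2, and the substitution \<open>t = K * (1 - s)\<close> leaves an incomplete Gamma
  integral. For \<open>s < 1/2\<close> the remaining factors are at most a multiple of
  \<open>K powr (- b)\<close>, and \<open>s powr (1/2 - 1)\<close> is integrable. The sum
  \<open>?h\<close> of the two majorants dominates on all of \<open>{0..1}\<close>, so the interval
  of integration is never split.\<close>

lemma exp_decay_Beta_weight_bound:
  fixes b K :: real
  assumes b: "b > 0" and K: "K > 0"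
  shows "integral {0..1} (\<lambda>s. exp (- K * (1 - s)) * (s powr (1/2 - 1) * (1 - s) powr (b - 1)))
           \<le> (2 * Gamma b + 2 * b powr b * Beta (1/2) 1) * K powr (- b)" (is "integral _ ?f \<le> _")
proof -
  define g where "g = (\<lambda>t::real. t powr (b - 1) / exp t)"
  have gG: "(g has_integral Gamma b) {0..}"
    unfolding g_def by (rule Gamma_integral_real[OF b])
  have gi: "g integrable_on {0..K}"
  proof -
    have "g absolutely_integrable_on {0..}"
      by (rule nonnegative_absolutely_integrable_1) (use gG in \<open>auto simp: g_def integrable_on_def\<close>)
    hence "g absolutely_integrable_on {0..K}"
      by (rule set_integrable_subset) auto
    thus ?thesis by (rule set_lebesgue_integral_eq_integral)
  qed
  have gle: "integral {0..K} g \<le> Gamma b"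
    using integral_subset_le[of "{0..K}" "{0..}" g] gi gG
    by (auto simp: integrable_on_def integral_unique g_def)
  have "((\<lambda>s. g (- K * s + K)) has_integral (1 / \<bar>- K\<bar> ^ DIM(real)) *\<^sub>R integral {0..K} g)
          ((\<lambda>x. (1 / - K) *\<^sub>R x + - ((1 / - K) *\<^sub>R K)) ` cbox 0 K)"
    using has_integral_affinity[of g "integral {0..K} g" 0 K "-K" K] K gi
    by (simp add: has_integral_integral)
  moreover have "(\<lambda>x. (1 / - K) *\<^sub>R x + - ((1 / - K) *\<^sub>R K)) ` cbox 0 K = {0..1}"
    using image_affinity_atLeastAtMost[of "-1/K" 1 0 K] K by simp
  ultimately have g1: "((\<lambda>s. g (- K * s + K)) has_integral integral {0..K} g / K) {0..1}"
    using K by simp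
  have "((\<lambda>s. 2 * K powr (1 - b) * g (- K * s + K)) has_integral
           2 * K powr (1 - b) * (integral {0..K} g / K)) {0..1}"
    using g1 by (rule has_integral_mult_right)
  \<comment> \<open>The factor \<open>(1 - s) powr (1 - 1)\<close> equals 1 for
    \<open>s < 1\<close>; it is kept so that the integral of \<open>s powr (1/2 - 1)\<close> reads
    as a Beta value.\<close>
  moreover have "((\<lambda>s. 2 * b powr b * K powr (-b) * (s powr (1/2 - 1) * (1 - s) powr (1 - 1))) has_integral
           2 * b powr b * K powr (-b) * Beta (1/2) 1) {0..1}"
    by (intro has_integral_mult_right has_integral_Beta_real) auto
  ultimately have h: "((\<lambda>s. 2 * K powr (1 - b) * g (- K * s + K)
       + 2 * b powr b * K powr (-b) * (s powr (1/2 - 1) * (1 - s) powr (1 - 1))) has_integral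
       2 * K powr (1 - b) * (integral {0..K} g / K) + 2 * b powr b * K powr (-b) * Beta (1/2) 1) {0..1}"
       (is "(?h has_integral _) _")
    by (rule has_integral_add)
  have dom: "?f s \<le> ?h s" if s: "s \<in> {0..1}" for s
  proof (cases "s = 0 \<or> s = 1")
    \<comment> \<open>Since \<open>0 powr a = 0\<close> for every \<open>a\<close>,
      \<open>?f\<close> vanishes at both endpoints, even where the exponent is negative.\<close>
    case True
    thus ?thesis using b K by (auto simp: g_def)
  next
    case False
    hence s: "0 < s" "s < 1" using s by auto
    have Kg: "K powr (1 - b) * g (- K * s + K) = exp (- K * (1 - s)) * (1 - s) powr (b - 1)"
    proof -
      have "g (- K * s + K) = (K * (1 - s)) powr (b - 1) / exp (K * (1 - s))"
        by (simp add: g_def algebra_simps)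
      also have "\<dots> = K powr (b - 1) * (1 - s) powr (b - 1) * exp (- K * (1 - s))"
        using s K by (simp add: powr_mult exp_minus divide_inverse)
      finally show ?thesis using K
        by (simp add: powr_diff field_simps)
    qed
    show ?thesis
    proof (cases "s \<ge> 1/2")
      case True
      have "s powr (1/2 - 1) \<le> (1/2) powr (1/2 - 1)"
        using True s by (intro powr_mono2') auto
      also have "\<dots> \<le> (1/2) powr (-1)" by (intro powr_mono') auto
      finally have "s powr (1/2 - 1) \<le> 2" by (simp add: powr_minus)
      hence "?f s \<le> 2 * (exp (- K * (1 - s)) * (1 - s) powr (b - 1))"
        using mult_right_mono[of "s powr (1/2 - 1)" 2 "exp (- K * (1 - s)) * (1 - s) powr (b - 1)"]
        by (simp add: mult_ac)
      also have "\<dots> = 2 * K powr (1 - b) * g (- K * s + K)" using Kg by simp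
      also have "\<dots> \<le> ?h s" by simp
      finally show ?thesis .
    next
      case f: False
      define u where "u = 1 - s"
      have u: "u > 1/2" "u < 1" using f s by (auto simp: u_def)
      \<comment> \<open>The inequality \<open>x \<le> exp x\<close> at \<open>x = K * u / b\<close>,
        raised to the power \<open>b\<close>, lets the exponential beat
        \<open>(K * u) powr b\<close>; this is the source of \<open>b powr b\<close>. Dividing by
        \<open>u > 1/2\<close> afterwards lowers the exponent to \<open>b - 1\<close> at the cost of
        a factor 2.\<close>
      have "(K * u / b) powr b \<le> exp (K * u / b) powr b"
        using K u b exp_ge_add_one_self[of "K * u / b"] by (intro powr_mono2) (simp_all del: exp_ge_add_one_self)
      also have "\<dots> = exp (K * u)" using b by (simp add: powr_def)
      finally have "K powr b * u powr b / b powr b \<le> exp (K * u)"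
        using K u b by (simp add: powr_divide powr_mult)
      hence "exp (- (K * u)) * u powr b \<le> b powr b * K powr (- b)"
        using K b by (simp add: powr_minus exp_minus field_simps)
      hence "exp (- (K * u)) * u powr b / u \<le> b powr b * K powr (- b) / u"
        using u by (intro divide_right_mono) auto
      also have "\<dots> \<le> b powr b * K powr (- b) / (1/2)"
        using u by (intro divide_left_mono) auto
      finally have "exp (- (K * u)) * u powr (b - 1) \<le> 2 * b powr b * K powr (- b)"
        using u by (simp add: powr_diff)
      from mult_right_mono[OF this, of "s powr (1/2 - 1)"]
      have "?f s \<le> 2 * b powr b * K powr (-b) * (s powr (1/2 - 1) * (1 - s) powr (1 - 1))"
        using s by (simp add: u_def mult_ac)
      also have "\<dots> \<le> ?h s" using K by (simp add: g_def)
      finally show ?thesis .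
    qed
  qed
  have "integral {0..1} ?f \<le> 2 * K powr (1 - b) * (integral {0..K} g / K) + 2 * b powr b * K powr (-b) * Beta (1/2) 1"
    using exp_Beta_weight_integrable[OF b, of K] dom
    by (intro has_integral_le[OF integrable_integral h]) auto
  also have "\<dots> \<le> 2 * K powr (1 - b) * (Gamma b / K) + 2 * b powr b * K powr (-b) * Beta (1/2) 1"
    using gle K by (intro add_right_mono mult_left_mono divide_right_mono) auto
  also have "\<dots> = (2 * Gamma b + 2 * b powr b * Beta (1/2) 1) * K powr (- b)"
    using K by (simp add: powr_diff powr_minus field_simps)
  finally show ?thesis .
qed

section \<open>Poisson's integral for the Bessel series\<close>

lemma cosh_sums_even:
  fixes x :: "'a :: {banach, real_normed_field}"
  shows "(\<lambda>k. x ^ (2 * k) / fact (2 * k)) sums cosh x"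
proof -
  have "(\<lambda>k. (\<lambda>n. if even n then x ^ n /\<^sub>R fact n else 0) (2 * k)) sums cosh x"
    using cosh_converges[of x] by (subst sums_mono_reindex) (auto simp: strict_mono_def elim: evenE)
  thus ?thesis by (simp add: scaleR_conv_of_real field_simps)
qed

text \<open>The duplication formula for \<open>fact (2 * k)\<close> trades
  \<open>4 ^ k * fact k\<close> for \<open>fact (2 * k)\<close> and a value of Gamma at
  \<open>k + 1/2\<close>, which completes a Beta value. That value is the \<open>k\<close>-th moment
  of the Poisson weight, and what remains is the coefficient of \<open>cosh\<close>.\<close>

lemma bessel_coeff_eq_Beta:
  fixes \<nu> :: real and w :: complex
  assumes nu: "\<nu> > - 1/2"
  shows "(w\<^sup>2 / 4) ^ k / fact k * rGamma (of_real \<nu> + of_nat k + 1) =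
           w ^ (2 * k) / fact (2 * k) * of_real (Beta (real k + 1/2) (\<nu> + 1/2))
             / of_real (sqrt pi * Gamma (\<nu> + 1/2))"
proof -
  have "pochhammer (1/2) k = Gamma (real k + 1/2) / sqrt pi"
    using pochhammer_Gamma[of "1/2::real" k] nonpos_Ints_nonpos[of "1/2::real"] by (auto simp: Gamma_one_half_real add.commute)
  hence fd: "fact (2 * k) = 4 ^ k * (Gamma (real k + 1/2) / sqrt pi) * fact k"
    using fact_double[of k, where 'a = real] by (simp add: power_mult)
  have pos: "Gamma (real k + 1/2) > 0" "Gamma (\<nu> + 1/2) > 0" "Gamma (\<nu> + real k + 1) > 0"
    using nu by (auto intro!: Gamma_real_pos)
  have B: "Beta (real k + 1/2) (\<nu> + 1/2) =
          Gamma (real k + 1/2) * Gamma (\<nu> + 1/2) / Gamma (\<nu> + real k + 1)"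
    by (simp add: Beta_def algebra_simps)
  have id: "1 / (P * F * G3) = B / (P * (G1 / p) * F * (p * G2))"
    if "B = G1 * G2 / G3" "G1 > 0" "G2 > 0" "G3 > 0" "P > 0" "F > 0" "p > 0" for G1 G2 G3 B P F p :: real
    using that by (simp add: field_simps)
  have real_id: "1 / (4 ^ k * fact k * Gamma (\<nu> + real k + 1)) =
          Beta (real k + 1/2) (\<nu> + 1/2) / (fact (2 * k) * (sqrt pi * Gamma (\<nu> + 1/2)))"
    unfolding fd by (rule id[OF B pos]) auto
  have "rGamma (of_real \<nu> + of_nat k + 1 :: complex) = of_real (rGamma (\<nu> + real k + 1))"
    by (simp flip: rGamma_complex_of_real)
  hence "(w\<^sup>2 / 4) ^ k / fact k * rGamma (of_real \<nu> + of_nat k + 1) =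
      w ^ (2 * k) * of_real (1 / (4 ^ k * fact k * Gamma (\<nu> + real k + 1)))"
    by (simp add: power_divide rGamma_inverse_Gamma field_simps flip: power_mult)
  thus ?thesis unfolding real_id by simp
qed

text \<open>The Poisson integral representation of \<open>I\<^sub>\<nu>\<close>, in the variable \<open>s = t\<^sup>2\<close>.\<close>

lemma bessel_series_sums:
  fixes \<nu> :: real and w :: complex
  assumes nu: "\<nu> > - 1/2"
  defines "f \<equiv> (\<lambda>s. cosh (w * of_real (sqrt s)) * of_real (s powr (1/2 - 1) * (1 - s) powr (\<nu> + 1/2 - 1)))"
  shows "f integrable_on {0..1}"
    and "(\<lambda>k. (w\<^sup>2 / 4) ^ k / fact k * rGamma (of_real \<nu> + of_nat k + 1)) sums
           (integral {0..1} f / of_real (sqrt pi * Gamma (\<nu> + 1/2)))"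
proof -
  define W where "W = (\<lambda>s::real. s powr (1/2 - 1) * (1 - s) powr (\<nu> + 1/2 - 1))"
  define B where "B = (\<lambda>k. Beta (real k + 1/2) (\<nu> + 1/2))"
  define t where "t = (\<lambda>k s. w ^ (2 * k) / fact (2 * k) * of_real (s ^ k * W s))"
  define F where "F = (\<lambda>n s. \<Sum>k<n. t k s)"
  have W: "(W has_integral B 0) {0..1}"
    unfolding W_def B_def using has_integral_Beta_real[of "1/2" "\<nu> + 1/2"] nu by simp
  have tk: "(t k has_integral w ^ (2 * k) / fact (2 * k) * of_real (B k)) {0..1}" for k
  proof -
    have "((\<lambda>s. s powr (real k + 1/2 - 1) * (1 - s) powr (\<nu> + 1/2 - 1)) has_integral B k) {0..1}"
      unfolding B_def using nu by (intro has_integral_Beta_real) auto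
    \<comment> \<open>At \<open>s = 0\<close> both sides are 0, also for \<open>k = 0\<close>,
      because \<open>W 0 = 0\<close> by the convention on \<open>0 powr a\<close>.\<close>
    moreover have "s powr (real k + 1/2 - 1) * (1 - s) powr (\<nu> + 1/2 - 1) = s ^ k * W s"
      if "s \<in> {0..1}" for s
    proof (cases "s = 0")
      case False
      thus ?thesis using that powr_add[of s "real k" "1/2 - 1"] by (simp add: W_def powr_realpow)
    qed (simp add: W_def)
    ultimately have "((\<lambda>s. s ^ k * W s) has_integral B k) {0..1}"
      by (rule has_integral_eq[rotated]) auto
    hence "((\<lambda>s. of_real (s ^ k * W s) :: complex) has_integral of_real (B k)) {0..1}"
      by (rule has_integral_of_real)
    thus ?thesis unfolding t_def by (rule has_integral_mult_right)
  qed
  have Fi: "(F n has_integral (\<Sum>k<n. w ^ (2 * k) / fact (2 * k) * of_real (B k))) {0..1}" for n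
    unfolding F_def by (intro has_integral_sum tk) auto
  have W0: "W s \<ge> 0" for s by (simp add: W_def)
  \<comment> \<open>As \<open>s ^ k \<le> 1\<close>, the partial sums are dominated by those of
    \<open>cosh (norm w)\<close>, uniformly in \<open>n\<close> and \<open>s\<close>. Dominated
    convergence then exchanges sum and integral.\<close>
  have bound: "norm (F n s) \<le> cosh (norm w) * W s" if s: "s \<in> {0..1}" for n s
  proof -
    have "norm (F n s) \<le> (\<Sum>k<n. norm w ^ (2 * k) / fact (2 * k) * W s)"
      unfolding F_def
    proof (rule sum_norm_le)
      fix k
      have "norm (t k s) = norm w ^ (2 * k) / fact (2 * k) * (s ^ k * W s)"
        using s W0[of s] by (simp add: t_def norm_mult norm_divide norm_power)
      also have "\<dots> \<le> norm w ^ (2 * k) / fact (2 * k) * (1 * W s)"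
        using s W0[of s] by (intro mult_left_mono mult_right_mono power_le_one) auto
      finally show "norm (t k s) \<le> norm w ^ (2 * k) / fact (2 * k) * W s" by simp
    qed
    also have "\<dots> = (\<Sum>k<n. norm w ^ (2 * k) / fact (2 * k)) * W s" by (simp add: sum_distrib_right)
    also have "(\<Sum>k<n. norm w ^ (2 * k) / fact (2 * k)) \<le> cosh (norm w)"
      using cosh_sums_even[of "norm w"] sum_le_suminf[of "\<lambda>k. norm w ^ (2 * k) / fact (2 * k)" "{..<n}"]
      by (auto simp: sums_iff)
    finally show ?thesis using W0[of s] by (simp add: mult_right_mono)
  qed
  have lim: "(\<lambda>n. F n s) \<longlonglongrightarrow> f s" if s: "s \<in> {0..1}" for s
  proof -
    have "(\<lambda>k. (w * of_real (sqrt s)) ^ (2 * k) / fact (2 * k) * of_real (W s)) sums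
            (cosh (w * of_real (sqrt s)) * of_real (W s))"
      by (intro sums_mult2 cosh_sums_even)
    moreover have "(w * of_real (sqrt s)) ^ (2 * k) / fact (2 * k) * of_real (W s) = t k s" for k
    proof -
      have "(of_real (sqrt s) :: complex) ^ (2 * k) = of_real (s ^ k)"
        using s by (simp add: power_mult flip: of_real_power)
      thus ?thesis by (simp add: t_def power_mult_distrib)
    qed
    ultimately show ?thesis by (simp add: sums_def F_def f_def W_def)
  qed
  have hi: "(\<lambda>s. cosh (norm w) * W s) integrable_on {0..1}"
    using W by (intro integrable_on_mult_right) (auto simp: integrable_on_def)
  have Fi': "F n integrable_on {0..1}" for n using Fi by (auto simp: integrable_on_def)
  note dc = dominated_convergence[OF Fi' hi bound lim]
  show "f integrable_on {0..1}" by (rule dc(1))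
  have "(\<lambda>k. w ^ (2 * k) / fact (2 * k) * of_real (B k)) sums integral {0..1} f"
    using dc(2) unfolding sums_def integral_unique[OF Fi] .
  hence "(\<lambda>k. w ^ (2 * k) / fact (2 * k) * of_real (B k) / of_real (sqrt pi * Gamma (\<nu> + 1/2)))
      sums (integral {0..1} f / of_real (sqrt pi * Gamma (\<nu> + 1/2)))"
    by (rule sums_divide)
  thus "(\<lambda>k. (w\<^sup>2 / 4) ^ k / fact k * rGamma (of_real \<nu> + of_nat k + 1)) sums
           (integral {0..1} f / of_real (sqrt pi * Gamma (\<nu> + 1/2)))"
    unfolding B_def bessel_coeff_eq_Beta[OF nu] .
qed

section \<open>Growth of the Bessel series in a sector\<close>

text \<open>The factor of \<open>bessel_I\<close> that is a power series in \<open>w\<^sup>2\<close>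
  and needs no choice of branch. For real order the branch then enters only through the modulus of
  \<open>(w / 2) powr \<nu>\<close>.\<close>

definition bessel_series :: "real \<Rightarrow> complex \<Rightarrow> complex" where
  "bessel_series \<nu> w = (\<Sum>k. (w\<^sup>2 / 4) ^ k / fact k * rGamma (of_real \<nu> + of_nat k + 1))"

lemma norm_cosh_le_exp:
  fixes w :: complex
  assumes "Re w \<ge> 0"
  shows "norm (cosh w) \<le> exp (Re w)"
proof -
  have "norm (exp w + exp (- w)) \<le> norm (exp w) + norm (exp (- w))" by (rule norm_triangle_ineq)
  also have "\<dots> \<le> 2 * exp (Re w)" using assms by simp
  finally show ?thesis by (simp add: cosh_field_def norm_divide)
qed

text \<open>In Poisson's integral, \<open>exp (Re w * sqrt s)\<close> falls short of
  \<open>exp (Re w)\<close> by a factor decaying exponentially in \<open>1 - s\<close> at a rate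
  comparable to \<open>Re w\<close>, hence to \<open>cmod w\<close> when
  \<open>d * cmod w \<le> Re w\<close>. Integration against the weight turns this into the power
  \<open>- \<nu> - 1/2\<close>.\<close>

lemma bessel_series_bound_Poisson:
  fixes \<nu> d :: real
  assumes nu: "\<nu> > - 1/2" and d: "0 < d" "d \<le> 1"
  shows "\<exists>C>0. \<forall>w. d * cmod w \<le> Re w \<longrightarrow>
           cmod (bessel_series \<nu> w) \<le> C * exp (Re w) * (1 + 2 * cmod w) powr (- \<nu> - 1/2)"
proof -
  define b where "b = \<nu> + 1/2"
  have b: "b > 0" using nu by (simp add: b_def)
  have Gb: "Gamma b > 0" using b by (rule Gamma_real_pos)
  define M where "M = 2 * Gamma b + 2 * b powr b * Beta (1/2) 1"
  have "Beta (1/2) (1::real) \<ge> 0" by (simp add: Beta_def Gamma_real_nonneg)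
  hence M: "M > 0" using b Gb unfolding M_def by (intro add_pos_nonneg) auto
  define C where "C = exp 1 * M * (d / 4) powr (- b) / (sqrt pi * Gamma b)"
  have C: "C > 0" using M Gb d by (simp add: C_def)
  have "cmod (bessel_series \<nu> w) \<le> C * exp (Re w) * (1 + 2 * cmod w) powr (- b)"
    if w: "d * cmod w \<le> Re w" for w
  proof -
    define x where "x = Re w"
    \<comment> \<open>The rate is a multiple of \<open>1 + 2 * cmod w\<close>, so it stays positive
      near \<open>w = 0\<close>. The factor \<open>d / 4\<close> makes it at most
      \<open>x / 2 + 1 / 4\<close>.\<close>
    define K where "K = d * (1 + 2 * cmod w) / 4"
    have x: "x \<ge> 0" using w d unfolding x_def by (meson dual_order.trans less_imp_le mult_nonneg_nonneg norm_ge_zero)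
    have K: "K > 0" unfolding K_def using d by (intro divide_pos_pos mult_pos_pos add_pos_nonneg) auto
    have Kx: "K \<le> x / 2 + 1 / 4" using w d by (simp add: K_def x_def algebra_simps)
    define f where "f = (\<lambda>s. cosh (w * of_real (sqrt s)) * of_real (s powr (1/2 - 1) * (1 - s) powr (b - 1)))"
    define g where "g = (\<lambda>s. exp (- K * (1 - s)) * (s powr (1/2 - 1) * (1 - s) powr (b - 1)))"
    have gi: "g integrable_on {0..1}" unfolding g_def by (rule exp_Beta_weight_integrable[OF b])
    have fs: "f integrable_on {0..1}" "bessel_series \<nu> w = integral {0..1} f / of_real (sqrt pi * Gamma b)"
      using bessel_series_sums[OF nu, of w] unfolding f_def b_def bessel_series_def by (auto simp: sums_iff)
    have fg: "norm (f s) \<le> exp (x + 1) * g s" if s: "s \<in> {0..1}" for s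
    proof -
      \<comment> \<open>By the arithmetic-geometric mean inequality
        \<open>x * sqrt s \<le> x - x * (1 - s) / 2\<close>. The surplus \<open>1 / 4\<close> in the
        bound on \<open>K\<close> is paid for by the \<open>1\<close> in
        \<open>exp (x + 1)\<close>.\<close>
      have "2 * sqrt s \<le> 1 + s"
        using zero_le_power2[of "1 - sqrt s"] s by (simp add: power2_diff)
      from mult_left_mono[OF this x] have "2 * (x * sqrt s) \<le> x + s * x" by (simp add: algebra_simps)
      moreover have "K * (1 - s) \<le> (x / 2 + 1 / 4) * (1 - s)" using Kx s by (intro mult_right_mono) auto
      moreover have "(x / 2 + 1 / 4) * (1 - s) = x / 2 - s * x / 2 + 1 / 4 - s / 4" by (simp add: field_simps)
      moreover have "0 \<le> s" using s by simp
      ultimately have "x * sqrt s \<le> x + 1 + (- K * (1 - s))" unfolding mult_minus_left by linarith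
      hence "exp (x * sqrt s) \<le> exp (x + 1) * exp (- K * (1 - s))" by (simp flip: exp_add)
      moreover have "norm (cosh (w * of_real (sqrt s))) \<le> exp (x * sqrt s)"
        using norm_cosh_le_exp[of "w * of_real (sqrt s)"] x s by (simp add: x_def)
      ultimately have "norm (cosh (w * of_real (sqrt s))) \<le> exp (x + 1) * exp (- K * (1 - s))" by linarith
      from mult_right_mono[OF this, of "s powr (1/2 - 1) * (1 - s) powr (b - 1)"]
      show ?thesis by (simp add: f_def g_def norm_mult mult_ac)
    qed
    have "norm (integral {0..1} f) \<le> integral {0..1} (\<lambda>s. exp (x + 1) * g s)"
      using fs(1) gi fg by (intro integral_norm_bound_integral integrable_on_mult_right)
    also have "\<dots> = exp (x + 1) * integral {0..1} g" by simp
    also have "\<dots> \<le> exp (x + 1) * (M * K powr (- b))"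
      unfolding M_def g_def using exp_decay_Beta_weight_bound[OF b K] by (intro mult_left_mono) auto
    also have "K powr (- b) = (d / 4) powr (- b) * (1 + 2 * cmod w) powr (- b)"
      unfolding K_def using d powr_mult[of "d / 4" "1 + 2 * cmod w" "- b"] by (simp add: add_nonneg_nonneg)
    finally have "norm (integral {0..1} f) / (sqrt pi * Gamma b) \<le>
        exp (x + 1) * (M * ((d / 4) powr (- b) * (1 + 2 * cmod w) powr (- b))) / (sqrt pi * Gamma b)"
      using Gb by (intro divide_right_mono) auto
    moreover have "norm (bessel_series \<nu> w) = norm (integral {0..1} f) / (sqrt pi * Gamma b)"
      unfolding fs(2) norm_divide norm_of_real using Gb by simp
    ultimately show ?thesis by (simp add: C_def x_def exp_add mult_ac)
  qed
  moreover have "- b = - \<nu> - 1/2" by (simp add: b_def)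
  ultimately show ?thesis using C by auto
qed

text \<open>Write \<open>rGamma (\<nu> + k + 1)\<close> as \<open>(\<nu> + 1) + k\<close> times
  \<open>rGamma (\<nu> + k + 2)\<close>. The part with \<open>\<nu> + 1\<close> is the series of
  order \<open>\<nu> + 1\<close>; in the other part \<open>k\<close> cancels against the factorial
  and an index shift gives order \<open>\<nu> + 2\<close>. Both orders exceed \<open>- 1/2\<close>,
  where convergence is known.\<close>

lemma bessel_series_recurrence:
  fixes \<nu> :: real
  assumes nu: "\<nu> > - 3/2"
  shows "bessel_series \<nu> w = of_real (\<nu> + 1) * bessel_series (\<nu> + 1) w + w\<^sup>2 / 4 * bessel_series (\<nu> + 2) w"
proof -
  define q where "q = w\<^sup>2 / 4"
  define a where "a = (\<lambda>\<nu>::real. \<lambda>k. q ^ k / fact k * rGamma (of_real \<nu> + of_nat k + 1))"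
  have s: "a \<mu> sums bessel_series \<mu> w" if "\<mu> > - 1/2" for \<mu>
    using bessel_series_sums(2)[OF that, of w] by (simp add: a_def q_def bessel_series_def sums_iff)
  define c where "c = (\<lambda>k. of_nat k * q ^ k / fact k * rGamma (of_real \<nu> + of_nat k + 2))"
  have "c (Suc k) = q * a (\<nu> + 2) k" for k
  proof -
    have "complex_of_real \<nu> + of_nat (Suc k) + 2 = of_real (\<nu> + 2) + of_nat k + 1" by simp
    hence "rGamma (of_real \<nu> + of_nat (Suc k) + 2 :: complex) = rGamma (of_real (\<nu> + 2) + of_nat k + 1)"
      by (rule arg_cong)
    moreover have "of_nat (Suc k) * q ^ Suc k / fact (Suc k) = q * (q ^ k / fact k)"
      by (simp del: of_nat_Suc)
    ultimately show ?thesis unfolding c_def a_def by (simp only: mult.assoc)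
  qed
  hence "(\<lambda>k. c (Suc k)) sums (q * bessel_series (\<nu> + 2) w)"
    using s[of "\<nu> + 2"] nu by (simp add: sums_mult)
  \<comment> \<open>The shift adds no boundary term, since \<open>c 0 = 0\<close>.\<close>
  hence c: "c sums (q * bessel_series (\<nu> + 2) w)"
    using sums_Suc[of c] by (simp add: c_def)
  have "a \<nu> k = of_real (\<nu> + 1) * a (\<nu> + 1) k + c k" for k
  proof -
    have "rGamma (of_real \<nu> + of_nat k + 1 :: complex) =
        (of_real \<nu> + of_nat k + 1) * rGamma (of_real \<nu> + of_nat k + 2)"
      using rGamma_plus1[of "of_real \<nu> + of_nat k + 1 :: complex"] by (simp add: add_ac)
    moreover have "rGamma (of_real (\<nu> + 1) + of_nat k + 1) = rGamma (of_real \<nu> + of_nat k + 2 :: complex)"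
      by (simp add: add_ac)
    ultimately show ?thesis by (simp add: a_def c_def algebra_simps add_divide_distrib)
  qed
  hence "a \<nu> = (\<lambda>k. of_real (\<nu> + 1) * a (\<nu> + 1) k + c k)" by (rule ext)
  hence "a \<nu> sums (of_real (\<nu> + 1) * bessel_series (\<nu> + 1) w + q * bessel_series (\<nu> + 2) w)"
    using sums_add[OF sums_mult[OF s[of "\<nu> + 1"], of "of_real (\<nu> + 1)"] c] nu by (simp only:)
  thus ?thesis by (simp add: a_def q_def bessel_series_def sums_iff)
qed

text \<open>The order \<open>(c - 1) / 2\<close> of the kernel \<open>p_Bn\<close> is only known to
  exceed \<open>- 1\<close>, so Poisson's range does not suffice. In the recurrence, order
  \<open>\<nu> + 1\<close> decays faster than required by one power of \<open>X \<ge> 1\<close>,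
  which is dropped; order \<open>\<nu> + 2\<close> gains two powers, which absorb
  \<open>w\<^sup>2\<close>.\<close>

lemma bessel_series_bound:
  fixes \<nu> d :: real
  assumes nu: "\<nu> > - 3/2" and d: "0 < d" "d \<le> 1"
  shows "\<exists>C>0. \<forall>w. d * cmod w \<le> Re w \<longrightarrow>
           cmod (bessel_series \<nu> w) \<le> C * exp (Re w) * (1 + 2 * cmod w) powr (- \<nu> - 1/2)"
proof -
  obtain C1 where C1: "C1 > 0" "\<And>w. d * cmod w \<le> Re w \<Longrightarrow>
      cmod (bessel_series (\<nu> + 1) w) \<le> C1 * exp (Re w) * (1 + 2 * cmod w) powr (- (\<nu> + 1) - 1/2)"
    using bessel_series_bound_Poisson[of "\<nu> + 1" d] nu d by auto
  obtain C2 where C2: "C2 > 0" "\<And>w. d * cmod w \<le> Re w \<Longrightarrow>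
      cmod (bessel_series (\<nu> + 2) w) \<le> C2 * exp (Re w) * (1 + 2 * cmod w) powr (- (\<nu> + 2) - 1/2)"
    using bessel_series_bound_Poisson[of "\<nu> + 2" d] nu d by auto
  have "cmod (bessel_series \<nu> w) \<le> (\<bar>\<nu> + 1\<bar> * C1 + C2) * exp (Re w) * (1 + 2 * cmod w) powr (- \<nu> - 1/2)"
    if w: "d * cmod w \<le> Re w" for w
  proof -
    define X where "X = 1 + 2 * cmod w"
    define p where "p = - \<nu> - 1/2"
    have X: "X \<ge> 1" "(cmod w)\<^sup>2 \<le> X\<^sup>2" by (auto simp: X_def intro: power_mono)
    have "cmod (bessel_series (\<nu> + 1) w) \<le> C1 * exp (Re w) * X powr (- (\<nu> + 1) - 1/2)"
      using C1(2)[OF w] by (simp add: X_def)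
    also have "\<dots> \<le> C1 * exp (Re w) * X powr p"
      using X C1(1) by (intro mult_left_mono powr_mono) (auto simp: p_def)
    finally have 1: "\<bar>\<nu> + 1\<bar> * cmod (bessel_series (\<nu> + 1) w) \<le> \<bar>\<nu> + 1\<bar> * (C1 * exp (Re w) * X powr p)"
      by (rule mult_left_mono) auto
    have "cmod (w\<^sup>2 / 4) \<le> (cmod w)\<^sup>2" by (simp add: norm_divide norm_power)
    also note X(2)
    finally have "cmod (w\<^sup>2 / 4) \<le> X\<^sup>2" .
    hence "cmod (w\<^sup>2 / 4 * bessel_series (\<nu> + 2) w) \<le> X\<^sup>2 * (C2 * exp (Re w) * X powr (- (\<nu> + 2) - 1/2))"
      unfolding norm_mult
      using C2(2)[OF w] X by (intro mult_mono) (auto simp: X_def)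
    also have "\<dots> = C2 * exp (Re w) * (X powr 2 * X powr (- (\<nu> + 2) - 1/2))" using X by simp
    also have "X powr 2 * X powr (- (\<nu> + 2) - 1/2) = X powr p"
    proof -
      have "2 + (- (\<nu> + 2) - 1/2) = p" by (simp add: p_def)
      thus ?thesis by (simp only: flip: powr_add)
    qed
    finally have 2: "cmod (w\<^sup>2 / 4 * bessel_series (\<nu> + 2) w) \<le> C2 * exp (Re w) * X powr p" .
    have "cmod (bessel_series \<nu> w) \<le>
        cmod (of_real (\<nu> + 1) * bessel_series (\<nu> + 1) w) + cmod (w\<^sup>2 / 4 * bessel_series (\<nu> + 2) w)"
      unfolding bessel_series_recurrence[OF nu, of w] by (rule norm_triangle_ineq)
    also have "cmod (of_real (\<nu> + 1) * bessel_series (\<nu> + 1) w) = \<bar>\<nu> + 1\<bar> * cmod (bessel_series (\<nu> + 1) w)"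
      by (simp only: norm_mult norm_of_real)
    also note 1
    also note 2
    finally show ?thesis by (simp add: X_def p_def algebra_simps)
  qed
  moreover have "\<bar>\<nu> + 1\<bar> * C1 + C2 > 0" using C1(1) C2(1) by (simp add: add_nonneg_pos)
  ultimately show ?thesis by blast
qed

section \<open>The Bessel function against the Gaussian\<close>

lemma norm_bessel_I_eq:
  "cmod (bessel_I (of_real \<nu>) w) = (cmod w / 2) powr \<nu> * cmod (bessel_series \<nu> w)"
  using norm_powr_real_powr'[of "of_real \<nu>" "w / 2"]
  by (simp add: bessel_I_def bessel_series_def norm_mult norm_divide)

text \<open>The growth \<open>exp (Re w)\<close> at \<open>w = y * \<rho> / (2 * z)\<close> supplies
  the cross term missing in \<open>y\<^sup>2 + \<rho>\<^sup>2\<close>, so the exponents add up to a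
  multiple of \<open>- (y - \<rho>)\<^sup>2\<close>.\<close>

lemma gaussian_bessel_I_bound:
  fixes \<nu> d :: real
  assumes nu: "\<nu> > - 3/2" and d: "0 < d" "d \<le> 1"
  shows "\<exists>C>0. \<forall>z y \<rho>. z \<noteq> 0 \<longrightarrow> d * cmod z \<le> Re z \<longrightarrow> y > 0 \<longrightarrow> \<rho> > 0 \<longrightarrow>
           cmod (exp (- (of_real (y\<^sup>2 + \<rho>\<^sup>2) / (4 * z))) * bessel_I (of_real \<nu>) (of_real (y * \<rho>) / (2 * z))) \<le>
             C * (y * \<rho> / cmod z) powr \<nu> * (1 + y * \<rho> / cmod z) powr (- \<nu> - 1/2)
               * exp (- (d / 4 * ((y - \<rho>)\<^sup>2 / cmod z)))"
proof -
  obtain C where C: "C > 0" "\<And>w. d * cmod w \<le> Re w \<Longrightarrow>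
      cmod (bessel_series \<nu> w) \<le> C * exp (Re w) * (1 + 2 * cmod w) powr (- \<nu> - 1/2)"
    using bessel_series_bound[OF nu d] by blast
  have "cmod (exp (- (of_real (y\<^sup>2 + \<rho>\<^sup>2) / (4 * z))) * bessel_I (of_real \<nu>) (of_real (y * \<rho>) / (2 * z))) \<le>
             ((1/4) powr \<nu> * C) * (y * \<rho> / cmod z) powr \<nu> * (1 + y * \<rho> / cmod z) powr (- \<nu> - 1/2)
               * exp (- (d / 4 * ((y - \<rho>)\<^sup>2 / cmod z)))"
    if z: "z \<noteq> 0" "d * cmod z \<le> Re z" and yr: "y > 0" "\<rho> > 0" for z y \<rho>
  proof -
    define w where "w = of_real (y * \<rho>) / (2 * z)"
    \<comment> \<open>This is the real part of \<open>1 / z\<close>; every real part below is a real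
      multiple of it. The bound \<open>m \<ge> d / cmod z\<close> gives both the Gaussian rate and
      the sector condition for \<open>w\<close>.\<close>
    define m where "m = Re z / (cmod z)\<^sup>2"
    have nw: "cmod w = y * \<rho> / cmod z / 2" using yr by (simp add: w_def norm_divide norm_mult)
    have Re_quot: "Re (of_real a / (of_real b * z)) = a / b * m" for a b :: real
    proof -
      have "of_real a / (of_real b * z) = of_real (a / b) * inverse z"
        by (simp add: field_simps)
      thus ?thesis by (simp add: m_def cmod_power2 del: of_real_divide)
    qed
    have Rw: "Re w = y * \<rho> / 2 * m" unfolding w_def using Re_quot[of "y * \<rho>" 2] by simp
    have m: "m \<ge> d / cmod z"
    proof -
      have "d * cmod z / (cmod z)\<^sup>2 \<le> m" unfolding m_def using z by (intro divide_right_mono) auto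
      thus ?thesis using z by (simp add: power2_eq_square)
    qed
    have dw: "d * cmod w \<le> Re w"
      using mult_left_mono[OF m, of "y * \<rho> / 2"] yr by (simp add: nw Rw mult_ac)
    have e: "cmod (exp (- (of_real (y\<^sup>2 + \<rho>\<^sup>2) / (4 * z)))) * exp (Re w) \<le> exp (- (d / 4 * ((y - \<rho>)\<^sup>2 / cmod z)))"
    proof -
      have "Re (- (of_real (y\<^sup>2 + \<rho>\<^sup>2) / (4 * z))) + Re w = - ((y - \<rho>)\<^sup>2 / 4 * m)"
        using Re_quot[of "y\<^sup>2 + \<rho>\<^sup>2" 4] by (simp add: Rw power2_eq_square field_simps)
      also have "\<dots> \<le> - ((y - \<rho>)\<^sup>2 / 4 * (d / cmod z))"
        using m by (intro le_imp_neg_le mult_left_mono) auto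
      finally show ?thesis by (simp add: mult_ac flip: exp_add)
    qed
    have "cmod (bessel_I (of_real \<nu>) w) \<le> (cmod w / 2) powr \<nu> * (C * exp (Re w) * (1 + 2 * cmod w) powr (- \<nu> - 1/2))"
      unfolding norm_bessel_I_eq using C(2)[OF dw] by (rule mult_left_mono) auto
    hence "cmod (exp (- (of_real (y\<^sup>2 + \<rho>\<^sup>2) / (4 * z))) * bessel_I (of_real \<nu>) w) \<le>
        cmod (exp (- (of_real (y\<^sup>2 + \<rho>\<^sup>2) / (4 * z)))) *
          ((cmod w / 2) powr \<nu> * (C * exp (Re w) * (1 + 2 * cmod w) powr (- \<nu> - 1/2)))"
      unfolding norm_mult by (rule mult_left_mono) auto
    also have "\<dots> = (cmod w / 2) powr \<nu> * C * (1 + 2 * cmod w) powr (- \<nu> - 1/2) *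
        (cmod (exp (- (of_real (y\<^sup>2 + \<rho>\<^sup>2) / (4 * z)))) * exp (Re w))"
      by (simp only: mult_ac)
    also have "\<dots> \<le> (cmod w / 2) powr \<nu> * C * (1 + 2 * cmod w) powr (- \<nu> - 1/2) *
        exp (- (d / 4 * ((y - \<rho>)\<^sup>2 / cmod z)))"
      using e C(1) by (intro mult_left_mono mult_nonneg_nonneg) auto
    also have "(cmod w / 2) powr \<nu> = (1/4) powr \<nu> * (y * \<rho> / cmod z) powr \<nu>"
      using powr_mult[of "1/4" "y * \<rho> / cmod z" \<nu>] yr by (simp add: nw)
    also have "1 + 2 * cmod w = 1 + y * \<rho> / cmod z" by (simp add: nw)
    finally show ?thesis by (simp add: w_def mult_ac)
  qed
  moreover have "(1/4) powr \<nu> * C > 0" using C(1) by simp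
  ultimately show ?thesis by blast
qed

section \<open>Comparison of the weights after rescaling\<close>

text \<open>With \<open>s = 1 + \<bar>Y - R\<bar>\<close>, the maxima \<open>M\<close> and
  \<open>Q\<close> of \<open>Y\<close> and \<open>R\<close> with 1 satisfy
  \<open>Q \<le> M * s\<close>. Moreover \<open>M * Q \<le> s * (1 + Y * R)\<close>: either
  \<open>M * Q = Y * R\<close>, or one maximum is 1 and the other is at most \<open>s\<close>. Hence
  \<open>Q\<^sup>2 \<le> s * (M * Q)\<close> is at most
  \<open>s\<^sup>2 * (1 + Y * R)\<close>.\<close>

lemma max_one_le_sqrt_prod:
  fixes Y R :: real
  assumes "Y > 0" "R > 0"
  shows "max R 1 \<le> (1 + \<bar>Y - R\<bar>) * (1 + Y * R) powr (1/2)"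
proof -
  define s where "s = 1 + \<bar>Y - R\<bar>"
  define Q where "Q = max R 1"
  define M where "M = max Y 1"
  have s: "s \<ge> 1" and QM: "Q \<ge> 1" "M \<ge> 1" by (auto simp: s_def Q_def M_def)
  have "Q \<le> M + \<bar>Y - R\<bar>" by (auto simp: Q_def M_def)
  also have "\<bar>Y - R\<bar> \<le> M * \<bar>Y - R\<bar>" using mult_right_mono[OF QM(2), of "\<bar>Y - R\<bar>"] by simp
  finally have Q: "Q \<le> M * s" by (simp add: s_def algebra_simps)
  have MQ: "M * Q \<le> s * (1 + Y * R)"
  proof (cases "Y \<ge> 1 \<and> R \<ge> 1")
    case True
    hence "M * Q \<le> 1 * (1 + Y * R)" by (auto simp: M_def Q_def)
    also have "\<dots> \<le> s * (1 + Y * R)" using s assms by (intro mult_right_mono) (auto simp: add_nonneg_nonneg)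
    finally show ?thesis .
  next
    case False
    hence "M * Q \<le> s * 1" by (auto simp: M_def Q_def s_def max_def)
    also have "\<dots> \<le> s * (1 + Y * R)" using s assms by (intro mult_left_mono) auto
    finally show ?thesis .
  qed
  have "Q * Q \<le> (M * s) * Q" using Q QM by (intro mult_right_mono) auto
  also have "\<dots> \<le> s * (s * (1 + Y * R))" using MQ s mult_left_mono[OF MQ, of s] by (simp add: mult_ac)
  finally have "Q\<^sup>2 \<le> (s * sqrt (1 + Y * R))\<^sup>2"
    using assms by (simp add: power2_eq_square mult_ac add_nonneg_nonneg)
  hence "Q \<le> s * sqrt (1 + Y * R)"
    using s assms by (intro power2_le_imp_le[of Q]) (auto simp: add_nonneg_nonneg)
  thus ?thesis using assms by (simp add: powr_half_sqrt add_nonneg_nonneg Q_def s_def)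
qed

text \<open>The numbers \<open>Y\<close>, \<open>R\<close> and 1 are all at most
  \<open>s * Q\<close>, so \<open>1 + Y * R\<close> is at most twice its square.\<close>

lemma sqrt_prod_le_max_one:
  fixes Y R :: real
  assumes "Y > 0" "R > 0"
  shows "(1 + Y * R) powr (1/2) \<le> 2 * (1 + \<bar>Y - R\<bar>) * max R 1"
proof -
  define s where "s = 1 + \<bar>Y - R\<bar>"
  define Q where "Q = max R 1"
  have s: "s \<ge> 1" and Q: "Q \<ge> 1" "R \<le> Q" by (auto simp: s_def Q_def)
  have "Y \<le> s * Q"
  proof -
    have "Y \<le> Q + \<bar>Y - R\<bar>" by (auto simp: Q_def)
    also have "\<bar>Y - R\<bar> \<le> Q * \<bar>Y - R\<bar>" using mult_right_mono[OF Q(1), of "\<bar>Y - R\<bar>"] by simp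
    finally show ?thesis by (simp add: s_def algebra_simps)
  qed
  hence "Y * R \<le> (s * Q) * (s * Q)"
  proof (rule mult_mono)
    show "R \<le> s * Q" using Q(2) mult_right_mono[OF s, of Q] Q(1) by linarith
  qed (use s Q assms in auto)
  moreover have "1 \<le> (s * Q) * (s * Q)"
    using mult_mono[of 1 "s * Q" 1 "s * Q"] mult_mono[of 1 s 1 Q] s Q by simp
  ultimately have "1 + Y * R \<le> (2 * s * Q)\<^sup>2" by (simp add: power2_eq_square)
  hence "sqrt (1 + Y * R) \<le> 2 * s * Q" using s Q by (intro real_le_lsqrt) auto
  thus ?thesis using assms by (simp add: powr_half_sqrt add_nonneg_nonneg Q_def s_def)
qed

text \<open>From \<open>1 + t \<le> exp t\<close> and Young's inequality for \<open>N * t\<close>,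
  that is, \<open>(N - 2 * \<delta> * t)\<^sup>2 \<ge> 0\<close>.\<close>

lemma one_plus_powr_le_exp_square:
  fixes N \<delta> t :: real
  assumes "N \<ge> 0" "\<delta> > 0" "t \<ge> 0"
  shows "(1 + t) powr N \<le> exp (N\<^sup>2 / (4 * \<delta>)) * exp (\<delta> * t\<^sup>2)"
proof -
  have "(1 + t) powr N \<le> exp t powr N"
    using assms exp_ge_add_one_self[of t] by (intro powr_mono2) (auto simp del: exp_ge_add_one_self)
  also have "\<dots> = exp (N * t)" by (simp add: powr_def)
  also have "N * t \<le> N\<^sup>2 / (4 * \<delta>) + \<delta> * t\<^sup>2"
    using zero_le_power2[of "N - 2 * \<delta> * t"] assms by (simp add: power2_eq_square field_simps)
  finally show ?thesis by (simp flip: exp_add)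
qed

text \<open>As \<open>R = min R 1 * max R 1\<close>, only \<open>max R 1\<close> has to be played
  off against \<open>(1 + Y * R) powr (1/2)\<close>. The sign of \<open>c\<close> decides which of
  the two comparisons is needed.\<close>

lemma weight_bound_Bn:
  fixes Y R c :: real
  assumes YR: "Y > 0" "R > 0"
  shows "R powr c * (1 + Y * R) powr (- c / 2) \<le>
           2 powr \<bar>c\<bar> * (min R 1) powr c * (1 + \<bar>Y - R\<bar>) powr \<bar>c\<bar>"
proof -
  define s where "s = 1 + \<bar>Y - R\<bar>"
  define Q where "Q = max R 1"
  define T where "T = 1 + Y * R"
  have s: "s \<ge> 1" and Q: "Q \<ge> 1" by (auto simp: s_def Q_def)
  have T: "T > 0" using YR by (simp add: T_def add_pos_pos)
  have RQ: "R powr c = (min R 1) powr c * Q powr c"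
    using YR by (auto simp: Q_def min_def max_def simp flip: powr_mult)
  have "Q powr c * T powr (- c / 2) \<le> 2 powr \<bar>c\<bar> * s powr \<bar>c\<bar>"
  proof (cases "c \<ge> 0")
    case True
    have "Q powr c \<le> (s * T powr (1/2)) powr c"
      using True Q max_one_le_sqrt_prod[OF YR] by (intro powr_mono2) (auto simp: Q_def s_def T_def)
    also have "\<dots> = s powr c * T powr (c / 2)" using s by (simp add: powr_mult powr_powr)
    finally have "Q powr c * T powr (- c / 2) \<le> s powr c * T powr (c / 2) * T powr (- c / 2)"
      by (rule mult_right_mono) auto
    also have "\<dots> = s powr c" using T by (simp flip: powr_add mult.assoc add: mult.assoc)
    also have "\<dots> \<le> 2 powr \<bar>c\<bar> * s powr \<bar>c\<bar>"
      using True mult_right_mono[OF ge_one_powr_ge_zero[of 2 c], of "s powr c"] by simp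
    finally show ?thesis .
  next
    case False
    have "T powr (- c / 2) = (T powr (1/2)) powr (- c)" by (simp add: powr_powr)
    also have "\<dots> \<le> (2 * s * Q) powr (- c)"
      using False sqrt_prod_le_max_one[OF YR] by (intro powr_mono2) (auto simp: Q_def s_def T_def)
    also have "\<dots> = 2 powr (- c) * s powr (- c) * Q powr (- c)" using s Q by (simp add: powr_mult)
    finally have "Q powr c * T powr (- c / 2) \<le> Q powr c * (2 powr (- c) * s powr (- c) * Q powr (- c))"
      by (rule mult_left_mono) auto
    also have "\<dots> = 2 powr \<bar>c\<bar> * s powr \<bar>c\<bar>" using False Q by (simp add: powr_minus field_simps)
    finally show ?thesis .
  qed
  from mult_left_mono[OF this, of "(min R 1) powr c"] show ?thesis
    by (simp add: RQ s_def T_def mult_ac)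
qed

text \<open>Both maxima occur with positive exponents, 1 and \<open>1 - c\<close>, so upper bounds
  suffice. They produce \<open>(1 + Y * R) powr (1/2)\<close> to the power \<open>2 - c\<close>,
  which cancels the decay exactly.\<close>

lemma weight_bound_Bd:
  fixes Y R c :: real
  assumes YR: "Y > 0" "R > 0" and c: "c < 1"
  shows "R * Y powr (1 - c) * (1 + Y * R) powr (- (2 - c) / 2) \<le>
           (min Y 1) powr (1 - c) * min R 1 * (1 + \<bar>Y - R\<bar>) powr (2 - c)"
proof -
  define s where "s = 1 + \<bar>Y - R\<bar>"
  define Q where "Q = max R 1"
  define M where "M = max Y 1"
  define T where "T = 1 + Y * R"
  have s: "s \<ge> 1" and Q: "Q \<ge> 1" and M: "M \<ge> 1" by (auto simp: s_def Q_def M_def)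
  have T: "T > 0" using YR by (simp add: T_def add_pos_pos)
  have RQ: "R = min R 1 * Q" by (auto simp: Q_def min_def max_def)
  have YM: "Y powr (1 - c) = (min Y 1) powr (1 - c) * M powr (1 - c)"
    using YR by (auto simp: M_def min_def max_def simp flip: powr_mult)
  have QT: "Q \<le> s * T powr (1/2)"
    using max_one_le_sqrt_prod[OF YR] by (simp add: Q_def s_def T_def)
  have MT: "M \<le> s * T powr (1/2)"
    using max_one_le_sqrt_prod[OF YR(2,1)] by (simp add: M_def s_def T_def mult_ac abs_minus_commute)
  have "Q * M powr (1 - c) \<le> (s * T powr (1/2)) powr 1 * (s * T powr (1/2)) powr (1 - c)"
    using QT MT M Q s c by (intro mult_mono powr_mono2) auto
  also have "\<dots> = (s * T powr (1/2)) powr (2 - c)"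
    using powr_add[of "s * T powr (1/2)" 1 "1 - c"] by simp
  also have "\<dots> = s powr (2 - c) * T powr ((2 - c) / 2)" using s by (simp add: powr_mult powr_powr)
  finally have "Q * M powr (1 - c) * T powr (- (2 - c) / 2) \<le>
      s powr (2 - c) * T powr ((2 - c) / 2) * T powr (- (2 - c) / 2)"
    by (rule mult_right_mono) auto
  also have "\<dots> = s powr (2 - c)" using T by (simp add: mult.assoc flip: powr_add add_divide_distrib)
  finally have "Q * M powr (1 - c) * T powr (- (2 - c) / 2) \<le> s powr (2 - c)" .
  from mult_left_mono[OF this, of "(min Y 1) powr (1 - c) * min R 1"] YR
  show ?thesis by (subst RQ, subst YM) (simp add: s_def T_def mult_ac)
qed

section \<open>Kernel bounds on the sector\<close>

lemma sector_Re_ge: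
  assumes \<epsilon>: "0 < \<epsilon>" "\<epsilon> < pi / 2" and z: "z \<in> sector (pi / 2 - \<epsilon>)"
  shows "sin \<epsilon> * cmod z \<le> Re z"
proof -
  have "cos (pi / 2 - \<epsilon>) \<le> cos \<bar>Arg z\<bar>"
    using z \<epsilon> by (intro cos_monotone_0_pi_le) (auto simp: sector_def)
  hence "sin \<epsilon> \<le> cos (Arg z)" by (simp add: cos_diff)
  hence "cmod z * sin \<epsilon> \<le> cmod z * cos (Arg z)" by (rule mult_left_mono) auto
  also have "cmod z * cos (Arg z) = Re z" by (simp flip: Re_rcis add: rcis_cmod_Arg)
  finally show ?thesis by (simp add: mult.commute)
qed

text \<open>The scaling argument common to both kernels. It reduces the estimate to an inequality in
  \<open>Y\<close> and \<open>R\<close> that may lose a power of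
  \<open>1 + \<bar>Y - R\<bar>\<close>; half of the Gaussian rate \<open>d / 4\<close> pays for the
  loss, whence \<open>8 / d\<close> in the conclusion.\<close>

lemma rescaled_kernel_bound:
  fixes c \<nu> d N B :: real and W :: "real \<Rightarrow> real \<Rightarrow> real"
  assumes nu: "\<nu> > - 3/2" and d: "0 < d" "d \<le> 1" and N: "N \<ge> 0" and B: "B > 0"
    and W: "\<And>Y R. Y > 0 \<Longrightarrow> R > 0 \<Longrightarrow>
       R powr c * (Y * R) powr ((1 - c) / 2) * (Y * R) powr \<nu> * (1 + Y * R) powr (- \<nu> - 1/2)
         \<le> B * W Y R * (1 + \<bar>Y - R\<bar>) powr N"
    and W0: "\<And>Y R. Y > 0 \<Longrightarrow> R > 0 \<Longrightarrow> W Y R \<ge> 0"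
  shows "\<exists>C>0. \<forall>z y \<rho>. z \<noteq> 0 \<longrightarrow> d * cmod z \<le> Re z \<longrightarrow> y > 0 \<longrightarrow> \<rho> > 0 \<longrightarrow>
     cmod (1 / (2 * z) * of_real (\<rho> powr c * (y * \<rho>) powr ((1 - c) / 2)) *
       exp (- (of_real (y\<^sup>2 + \<rho>\<^sup>2) / (4 * z))) * bessel_I (of_real \<nu>) (of_real (y * \<rho>) / (2 * z)))
     \<le> C * cmod z powr (- 1/2) * W (y / cmod z powr (1/2)) (\<rho> / cmod z powr (1/2))
          * exp (- (\<bar>y - \<rho>\<bar>\<^sup>2 / (8 / d * cmod z)))"
proof -
  obtain C where C: "C > 0" and
    gb: "\<And>z y \<rho>. z \<noteq> 0 \<Longrightarrow> d * cmod z \<le> Re z \<Longrightarrow> y > 0 \<Longrightarrow> \<rho> > 0 \<Longrightarrow>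
           cmod (exp (- (of_real (y\<^sup>2 + \<rho>\<^sup>2) / (4 * z))) * bessel_I (of_real \<nu>) (of_real (y * \<rho>) / (2 * z))) \<le>
             C * (y * \<rho> / cmod z) powr \<nu> * (1 + y * \<rho> / cmod z) powr (- \<nu> - 1/2)
               * exp (- (d / 4 * ((y - \<rho>)\<^sup>2 / cmod z)))"
    using gaussian_bessel_I_bound[OF nu d] by blast
  \<comment> \<open>The constant from \<open>one_plus_powr_le_exp_square\<close> at
    \<open>\<delta> = d / 8\<close>, half of the available rate.\<close>
  define E where "E = exp (N\<^sup>2 / (4 * (d / 8)))"
  define C' where "C' = C * B * E / 2"
  have C': "C' > 0" using C B by (simp add: C'_def E_def)
  have "cmod (1 / (2 * z) * of_real (\<rho> powr c * (y * \<rho>) powr ((1 - c) / 2)) *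
       exp (- (of_real (y\<^sup>2 + \<rho>\<^sup>2) / (4 * z))) * bessel_I (of_real \<nu>) (of_real (y * \<rho>) / (2 * z)))
     \<le> C' * cmod z powr (- 1/2) * W (y / cmod z powr (1/2)) (\<rho> / cmod z powr (1/2))
          * exp (- (\<bar>y - \<rho>\<bar>\<^sup>2 / (8 / d * cmod z)))"
    if z: "z \<noteq> 0" "d * cmod z \<le> Re z" and pos: "y > 0" "\<rho> > 0" for z y \<rho>
  proof -
    define r where "r = cmod z powr (1/2)"
    define Y where "Y = y / r"
    define R where "R = \<rho> / r"
    have r: "r > 0" using z by (simp add: r_def)
    have rr: "cmod z = r * r" using z by (simp add: r_def flip: powr_add)
    have rinv: "cmod z powr (- 1/2) = 1 / r" using z by (simp add: r_def powr_minus_divide)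
    have YR: "Y > 0" "R > 0" and yr: "y = r * Y" "\<rho> = r * R" using pos r by (auto simp: Y_def R_def)
    have T: "y * \<rho> / cmod z = Y * R" using r by (simp add: yr rr)
    have D: "(y - \<rho>)\<^sup>2 / cmod z = \<bar>Y - R\<bar>\<^sup>2"
      using r by (simp add: yr rr power2_eq_square field_simps)
    define g where "g = exp (- (d / 4 * \<bar>Y - R\<bar>\<^sup>2))"
    \<comment> \<open>The prefactor is homogeneous of degree 1 in \<open>(y, \<rho>)\<close>, so it
      yields a single \<open>r\<close>; against \<open>1 / (2 * cmod z)\<close> this leaves
      \<open>1 / (2 * r)\<close>.\<close>
    have "\<rho> powr c * (y * \<rho>) powr ((1 - c) / 2) = r powr (c + (1 - c) / 2 + (1 - c) / 2) * (R powr c * (Y * R) powr ((1 - c) / 2))"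
      unfolding powr_add using r YR by (simp add: yr powr_mult)
    also have "c + (1 - c) / 2 + (1 - c) / 2 = 1" by (simp add: field_simps)
    finally have w: "\<rho> powr c * (y * \<rho>) powr ((1 - c) / 2) = r * (R powr c * (Y * R) powr ((1 - c) / 2))"
      using r by simp
    have "cmod (1 / (2 * z) * of_real (\<rho> powr c * (y * \<rho>) powr ((1 - c) / 2)) *
         exp (- (of_real (y\<^sup>2 + \<rho>\<^sup>2) / (4 * z))) * bessel_I (of_real \<nu>) (of_real (y * \<rho>) / (2 * z)))
       = 1 / (2 * cmod z) * (\<rho> powr c * (y * \<rho>) powr ((1 - c) / 2)) *
         cmod (exp (- (of_real (y\<^sup>2 + \<rho>\<^sup>2) / (4 * z))) * bessel_I (of_real \<nu>) (of_real (y * \<rho>) / (2 * z)))"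
      by (simp add: norm_mult norm_divide)
    also have "\<dots> \<le> 1 / (2 * cmod z) * (\<rho> powr c * (y * \<rho>) powr ((1 - c) / 2)) *
        (C * (Y * R) powr \<nu> * (1 + Y * R) powr (- \<nu> - 1/2) * g)"
      using gb[OF z pos] unfolding T D g_def by (rule mult_left_mono) auto
    also have "\<dots> = C / (2 * r) * g *
        (R powr c * (Y * R) powr ((1 - c) / 2) * (Y * R) powr \<nu> * (1 + Y * R) powr (- \<nu> - 1/2))"
      using r unfolding w rr by (simp add: field_simps)
    also have "\<dots> \<le> C / (2 * r) * g * (B * W Y R * (1 + \<bar>Y - R\<bar>) powr N)"
      using W[OF YR] C r by (intro mult_left_mono) (auto simp: g_def)
    also have "\<dots> \<le> C / (2 * r) * g * (B * W Y R * (E * exp (d / 8 * \<bar>Y - R\<bar>\<^sup>2)))"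
      unfolding E_def using C r B d N W0[OF YR]
      by (intro mult_left_mono one_plus_powr_le_exp_square) (auto simp: g_def)
    also have "\<dots> = C' * (1 / r) * W Y R * (g * exp (d / 8 * \<bar>Y - R\<bar>\<^sup>2))"
      by (simp add: C'_def)
    also have "g * exp (d / 8 * \<bar>Y - R\<bar>\<^sup>2) = exp (- (d / 8 * \<bar>Y - R\<bar>\<^sup>2))"
      by (simp add: g_def flip: exp_add)
    also have "d / 8 * \<bar>Y - R\<bar>\<^sup>2 = \<bar>y - \<rho>\<bar>\<^sup>2 / (8 / d * cmod z)"
      unfolding D[symmetric] using d by simp
    finally show ?thesis unfolding rinv by (simp add: Y_def R_def r_def)
  qed
  thus ?thesis using C' by blast
qed

text \<open>For \<open>\<nu> = (c - 1) / 2\<close> the powers of \<open>Y * R\<close> outside and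
  inside the Bessel function cancel, so no separate power of \<open>Y\<close> remains.\<close>

lemma p_Bn_bound:
  fixes c d :: real
  assumes c: "c > -1" and d: "0 < d" "d \<le> 1"
  shows "\<exists>C>0. \<forall>z y \<rho>. z \<noteq> 0 \<longrightarrow> d * cmod z \<le> Re z \<longrightarrow> y > 0 \<longrightarrow> \<rho> > 0 \<longrightarrow>
     cmod (p_Bn c z y \<rho>) \<le> C * cmod z powr (- 1/2) * (min (\<rho> / cmod z powr (1/2)) 1) powr c
          * exp (- (\<bar>y - \<rho>\<bar>\<^sup>2 / (8 / d * cmod z)))"
proof -
  have "R powr c * (Y * R) powr ((1 - c) / 2) * (Y * R) powr ((c - 1) / 2) * (1 + Y * R) powr (- ((c - 1) / 2) - 1/2)
      \<le> 2 powr \<bar>c\<bar> * (min R 1) powr c * (1 + \<bar>Y - R\<bar>) powr \<bar>c\<bar>"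
    if YR: "Y > 0" "R > 0" for Y R :: real
  proof -
    have "(Y * R) powr ((1 - c) / 2) * (Y * R) powr ((c - 1) / 2) = 1"
      using YR by (simp flip: powr_add add_divide_distrib)
    moreover have "- ((c - 1) / 2) - 1/2 = - c / 2" by (simp add: field_simps)
    ultimately show ?thesis using weight_bound_Bn[OF YR, of c] by (simp add: mult.assoc)
  qed
  from rescaled_kernel_bound[OF _ d _ _ this] c show ?thesis
    unfolding p_Bn_def by simp
qed

text \<open>For \<open>\<nu> = (1 - c) / 2\<close> the two powers of \<open>Y * R\<close> combine to
  exponent \<open>1 - c\<close>, and with \<open>R powr c\<close> they leave
  \<open>R * Y powr (1 - c)\<close>.\<close>

lemma p_Bd_bound:
  fixes c d :: real
  assumes c: "c < 1" and d: "0 < d" "d \<le> 1"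
  shows "\<exists>C>0. \<forall>z y \<rho>. z \<noteq> 0 \<longrightarrow> d * cmod z \<le> Re z \<longrightarrow> y > 0 \<longrightarrow> \<rho> > 0 \<longrightarrow>
     cmod (p_Bd c z y \<rho>) \<le> C * cmod z powr (- 1/2)
          * ((min (y / cmod z powr (1/2)) 1) powr (1 - c) * min (\<rho> / cmod z powr (1/2)) 1)
          * exp (- (\<bar>y - \<rho>\<bar>\<^sup>2 / (8 / d * cmod z)))"
proof -
  have "R powr c * (Y * R) powr ((1 - c) / 2) * (Y * R) powr ((1 - c) / 2) * (1 + Y * R) powr (- ((1 - c) / 2) - 1/2)
      \<le> 1 * ((min Y 1) powr (1 - c) * min R 1) * (1 + \<bar>Y - R\<bar>) powr (2 - c)"
    if YR: "Y > 0" "R > 0" for Y R :: real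
  proof -
    have "R powr c * ((Y * R) powr ((1 - c) / 2) * (Y * R) powr ((1 - c) / 2)) = R powr c * (Y * R) powr (1 - c)"
      by (simp flip: powr_add)
    also have "\<dots> = R powr (c + (1 - c)) * Y powr (1 - c)"
      unfolding powr_add using YR by (simp add: powr_mult)
    also have "\<dots> = R * Y powr (1 - c)" using YR by simp
    finally have "R powr c * ((Y * R) powr ((1 - c) / 2) * (Y * R) powr ((1 - c) / 2)) = R * Y powr (1 - c)" .
    moreover have "- ((1 - c) / 2) - 1/2 = - (2 - c) / 2" by (simp add: field_simps)
    ultimately show ?thesis using weight_bound_Bd[OF YR c] by (simp only: flip: mult.assoc)
  qed
  from rescaled_kernel_bound[OF _ d _ _ this] c show ?thesis
    unfolding p_Bd_def by simp
qed

theorem proposition2p8: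
  fixes c \<epsilon> :: real
  assumes "0 < \<epsilon>" and "\<epsilon> < pi / 2"
  shows "\<exists>C > 0. \<exists>\<kappa> > 0. \<forall>z \<in> sector (pi / 2 - \<epsilon>). \<forall>y > 0. \<forall>\<rho> > 0.
    (c < 1 \<longrightarrow>
      cmod (p_Bd c z y \<rho>) \<le>
        C * cmod z powr (- 1 / 2)
          * (min (y / cmod z powr (1 / 2)) 1) powr (1 - c)
          * min (\<rho> / cmod z powr (1 / 2)) 1
          * exp (- (\<bar>y - \<rho>\<bar>\<^sup>2 / (\<kappa> * cmod z)))) \<and>
    (c > -1 \<longrightarrow>
      cmod (p_Bn c z y \<rho>) \<le>
        C * cmod z powr (- 1 / 2)
          * (min (\<rho> / cmod z powr (1 / 2)) 1) powr c
          * exp (- (\<bar>y - \<rho>\<bar>\<^sup>2 / (\<kappa> * cmod z))))"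
proof -
  define d where "d = sin \<epsilon>"
  have d: "0 < d" "d \<le> 1" using assms pi_gt_zero by (auto simp: d_def intro!: sin_gt_zero)
  define E where "E = (\<lambda>z y \<rho>. exp (- (\<bar>y - \<rho>\<bar>\<^sup>2 / (8 / d * cmod z))))"
  define V where "V = (\<lambda>z y \<rho>. cmod z powr (- 1/2) *
      ((min (y / cmod z powr (1/2)) 1) powr (1 - c) * min (\<rho> / cmod z powr (1/2)) 1) * E z y \<rho>)"
  define U where "U = (\<lambda>z y \<rho>. cmod z powr (- 1/2) * (min (\<rho> / cmod z powr (1/2)) 1) powr c * E z y \<rho>)"
  obtain C1 where C1: "C1 > 0" and 1: "\<And>z y \<rho>. c < 1 \<Longrightarrow> z \<noteq> 0 \<Longrightarrow> d * cmod z \<le> Re z \<Longrightarrow> y > 0 \<Longrightarrow> \<rho> > 0 \<Longrightarrow>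
      cmod (p_Bd c z y \<rho>) \<le> C1 * V z y \<rho>"
  \<comment> \<open>The same constants must serve for every \<open>c\<close>; outside the range of
    the kernel the claim is vacuous and the constant 1 is a dummy.\<close>
  proof (cases "c < 1")
    case True
    show ?thesis using p_Bd_bound[OF True d] that unfolding V_def E_def by (auto simp: mult.assoc)
  qed (use that[of 1] in auto)
  obtain C2 where C2: "C2 > 0" and 2: "\<And>z y \<rho>. c > -1 \<Longrightarrow> z \<noteq> 0 \<Longrightarrow> d * cmod z \<le> Re z \<Longrightarrow> y > 0 \<Longrightarrow> \<rho> > 0 \<Longrightarrow>
      cmod (p_Bn c z y \<rho>) \<le> C2 * U z y \<rho>"
  proof (cases "c > -1")
    case True
    show ?thesis using p_Bn_bound[OF True d] that unfolding U_def E_def by (auto simp: mult.assoc)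
  qed (use that[of 1] in auto)
  \<comment> \<open>Nonnegativity allows each constant to be enlarged to \<open>C1 + C2\<close>.
    Here \<open>\<rho> > 0\<close> matters because \<open>min (\<rho> / cmod z powr (1/2)) 1\<close>
    enters as a plain factor and not under \<open>powr\<close>.\<close>
  have V0: "V z y \<rho> \<ge> 0" if "\<rho> > 0" for z y \<rho>
    using that by (simp add: V_def E_def)
  have U0: "U z y \<rho> \<ge> 0" for z y \<rho> by (simp add: U_def E_def)
  show ?thesis
  proof (rule exI[of _ "C1 + C2"], rule conjI[rotated], rule exI[of _ "8 / d"], intro conjI ballI allI impI)
    fix z y \<rho> assume z: "z \<in> sector (pi / 2 - \<epsilon>)" and pos: "(0::real) < y" "(0::real) < \<rho>"
    have z': "z \<noteq> 0" "d * cmod z \<le> Re z"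
      using z sector_Re_ge[OF assms z] by (auto simp: sector_def d_def)
    {
      assume "c < 1"
      from 1[OF this z' pos] have "cmod (p_Bd c z y \<rho>) \<le> (C1 + C2) * V z y \<rho>"
        using mult_nonneg_nonneg[OF less_imp_le[OF C2] V0[OF pos(2), of z y]] by (simp add: distrib_right)
      thus "cmod (p_Bd c z y \<rho>) \<le> (C1 + C2) * cmod z powr (- 1 / 2)
          * (min (y / cmod z powr (1 / 2)) 1) powr (1 - c) * min (\<rho> / cmod z powr (1 / 2)) 1
          * exp (- (\<bar>y - \<rho>\<bar>\<^sup>2 / (8 / d * cmod z)))"
        unfolding V_def E_def by (simp only: mult.assoc)
    }
    {
      assume "-1 < c"
      from 2[OF this z' pos] have "cmod (p_Bn c z y \<rho>) \<le> (C1 + C2) * U z y \<rho>"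
        using mult_nonneg_nonneg[OF less_imp_le[OF C1] U0[of z y \<rho>]] by (simp add: distrib_right)
      thus "cmod (p_Bn c z y \<rho>) \<le> (C1 + C2) * cmod z powr (- 1 / 2)
          * (min (\<rho> / cmod z powr (1 / 2)) 1) powr c
          * exp (- (\<bar>y - \<rho>\<bar>\<^sup>2 / (8 / d * cmod z)))"
        unfolding U_def E_def by (simp only: mult.assoc)
    }
  qed (use C1 C2 d in auto)
qed

end
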